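(* Let $S=\langle g_1,\dots,g_n\rangle$ be a numerical semigroup and $R=K[[t^S]]$ with maximal ideal $\mathbf m$. Suppose $G(\mathbf m)$ is Buchsbaum. Then, for every $i\in\{0,\dots,g_1-1\}$, $a_i>b_i$ implies $\omega_i\in\mathrm{maxAp}_M(S)$.
   Context: $K$ is an infinite field. A numerical semigroup $S\subseteq\mathbb N$ (with $0\in S$) has minimal generators $g_1<\dots<g_n$ with $\gcd(g_1,\dots,g_n)=1$. $R=K[[t^S]]=K[[t^{g_1},\dots,t^{g_n}]]$, $\mathbf m=(t^{g_1},\dots,t^{g_n})$, $G(\mathbf m)=\bigoplus_{i\ge0}\mathbf m^i/\mathbf m^{i+1}$, and $\mathcal M$ is the homogeneous maximal ideal of $G(\mathbf m)$. $G(\mathbf m)$ is called Buchsbaum if $\mathcal M\cdot H^0_{\mathcal M}=0$, where $H^0_{\mathcal M}=\bigcup_{k\ge1}(0:_{G(\mathbf m)}\mathcal M^k)$. Apery set: $\mathrm{Ap}_{g_1}(S)=\{\omega_0,\dots,\omega_{g_1-1}\}$, where $\omega_i=\min\{s\in S: s\equiv i \bmod g_1\}$. Let $S'=\langle g_1,g_2-g_1,\dots,g_n-g_1\rangle$ and $\omega'_i=\min\{s\in S': s\equiv i\bmod g_1\}$. Let $M=S\setminus\{0\}$, $hM=M+\dots+M$ ($h$ summands), $0M=S$. For $0\le i\le g_1-1$, $a_i$ is the integer with $\omega'_i+a_ig_1=\omega_i$, and $b_i=\max\{l:\omega_i\in lM\}$; one always has $b_i\le a_i$. For $s\in S$, $\mathrm{ord}(s)=h$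 if $s\in hM\setminus(h+1)M$. Partial order on $S$: $u\le_M u'$ if there is $s\in S$ with $u+s=u'$ and $\mathrm{ord}(u)+\mathrm{ord}(s)=\mathrm{ord}(u')$. $\mathrm{maxAp}_M(S)$ is the set of maximal elements of $\mathrm{Ap}_{g_1}(S)$ with respect to $\le_M$. *)

theory Defs
  imports "HOL-Computational_Algebra.Formal_Power_Series" "HOL-Algebra.QuotRing" "HOL-Algebra.Ideal_Product"
begin

section \<open>Associated graded rings\<close>

abbreviation ideal_pow :: "('a, 'b) ring_scheme \<Rightarrow> 'a set \<Rightarrow> nat \<Rightarrow> 'a set" where
  "ideal_pow R I i \<equiv> I [^]\<^bsub>ideals_set R\<^esub> i"

text \<open>
  The ring \<open>\<Oplus>\<^sub>i I\<^sup>i / I\<^sup>i\<^sup>+\<^sup>1\<close>. An element is the sequence of its homogeneous components, component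
  \<open>i\<close> being a coset of \<open>I\<^sup>i\<^sup>+\<^sup>1\<close> with a representative in \<open>I\<^sup>i\<close>. Thus \<open>I\<^sup>i / I\<^sup>i\<^sup>+\<^sup>1\<close> lies inside
  \<open>R / I\<^sup>i\<^sup>+\<^sup>1\<close>, and the convolution sum in degree \<open>k\<close> is taken in \<open>R / I\<^sup>k\<^sup>+\<^sup>1\<close>. For
  \<open>a \<in> I\<^sup>i\<close> and \<open>b \<in> I\<^sup>j\<close> with \<open>i + j = k\<close> the product of \<open>a + I\<^sup>i\<^sup>+\<^sup>1\<close> and \<open>b + I\<^sup>j\<^sup>+\<^sup>1\<close> formed by
  \<^const>\<open>rcoset_mult\<close> modulo \<open>I\<^sup>k\<^sup>+\<^sup>1\<close> is \<open>ab + I\<^sup>k\<^sup>+\<^sup>1\<close>.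
\<close>
definition assoc_graded :: "('a, 'b) ring_scheme \<Rightarrow> 'a set \<Rightarrow> (nat \<Rightarrow> 'a set) ring" where
  "assoc_graded R I =
    \<lparr> carrier = {x. (\<forall>i. x i \<in> (\<lambda>a. ideal_pow R I (Suc i) +>\<^bsub>R\<^esub> a) ` ideal_pow R I i)
                    \<and> finite {i. x i \<noteq> ideal_pow R I (Suc i)}},
      mult = (\<lambda>x y k. finsum (R Quot ideal_pow R I (Suc k))
                (\<lambda>i. rcoset_mult R (ideal_pow R I (Suc k)) (x i) (y (k - i))) {..k}),
      one = (\<lambda>i. if i = 0 then ideal_pow R I 1 +>\<^bsub>R\<^esub> \<one>\<^bsub>R\<^esub> else ideal_pow R I (Suc i)),
      zero = (\<lambda>i. ideal_pow R I (Suc i)),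
      add = (\<lambda>x y i. x i <+>\<^bsub>R\<^esub> y i) \<rparr>"

text \<open>
  The ideal \<open>\<Oplus>\<^sub>i\<^sub>\<ge>\<^sub>1 I\<^sup>i / I\<^sup>i\<^sup>+\<^sup>1\<close>. When \<open>I\<close> is a maximal ideal, the degree-zero part \<open>R / I\<close> is a field
  and this is the homogeneous maximal ideal.
\<close>
definition graded_irrelevant_ideal :: "('a, 'b) ring_scheme \<Rightarrow> 'a set \<Rightarrow> (nat \<Rightarrow> 'a set) set" where
  "graded_irrelevant_ideal R I =
    {x \<in> carrier (assoc_graded R I). x 0 = \<zero>\<^bsub>assoc_graded R I\<^esub> 0}"

definition annihilator :: "('a, 'b) ring_scheme \<Rightarrow> 'a set \<Rightarrow> 'a set" where
  "annihilator G J = {x \<in> carrier G. \<forall>y\<in>J. x \<otimes>\<^bsub>G\<^esub> y = \<zero>\<^bsub>G\<^esub>}"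

definition local_cohomology0 :: "('a, 'b) ring_scheme \<Rightarrow> 'a set \<Rightarrow> 'a set" where
  "local_cohomology0 G J = (\<Union>k\<in>{1::nat..}. annihilator G (ideal_pow G J k))"

definition assoc_graded_buchsbaum :: "('a, 'b) ring_scheme \<Rightarrow> 'a set \<Rightarrow> bool" where
  "assoc_graded_buchsbaum R I \<longleftrightarrow>
    ideal_prod (assoc_graded R I) (graded_irrelevant_ideal R I)
      (local_cohomology0 (assoc_graded R I) (graded_irrelevant_ideal R I))
    = {\<zero>\<^bsub>assoc_graded R I\<^esub>}"


section \<open>Numerical semigroups\<close>

inductive_set submonoid_gen :: "nat set \<Rightarrow> nat set" for A :: "nat set" where
  zero: "0 \<in> submonoid_gen A"
| add: "a \<in> A \<Longrightarrow> s \<in> submonoid_gen A \<Longrightarrow> a + s \<in> submonoid_gen A"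

text \<open>Positivity of the generators follows from minimality, since \<open>0\<close> is always generated.\<close>
definition numerical_semigroup_mingens :: "nat set \<Rightarrow> nat list \<Rightarrow> bool" where
  "numerical_semigroup_mingens S gs \<longleftrightarrow>
    sorted_wrt (<) gs \<and> Gcd (set gs) = 1 \<and> S = submonoid_gen (set gs) \<and>
    (\<forall>g\<in>set gs. g \<notin> submonoid_gen (set gs - {g}))"

definition blowup_semigroup :: "nat list \<Rightarrow> nat set" where
  "blowup_semigroup gs = submonoid_gen (set (hd gs # map (\<lambda>g. g - hd gs) (tl gs)))"

definition apery_elem :: "nat set \<Rightarrow> nat \<Rightarrow> nat \<Rightarrow> nat" where
  "apery_elem S m i = (LEAST s. s \<in> S \<and> s mod m = i mod m)"

definition apery_set :: "nat set \<Rightarrow> nat \<Rightarrow> nat set" where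
  "apery_set S m = apery_elem S m ` {..<m}"

text \<open>\<open>hM = M + \<dots> + M\<close> with \<open>h\<close> summands, where \<open>M = S \<setminus> {0}\<close> and \<open>0M = S\<close>\<close>
definition multM :: "nat set \<Rightarrow> nat \<Rightarrow> nat set" where
  "multM S h =
    (if h = 0 then S else {sum_list xs | xs. length xs = h \<and> set xs \<subseteq> S - {0}})"

text \<open>Meaningful for \<open>s \<in> S\<close> only\<close>
definition ord_sg :: "nat set \<Rightarrow> nat \<Rightarrow> nat" where
  "ord_sg S s = (THE h. s \<in> multM S h \<and> s \<notin> multM S (Suc h))"

definition le_M :: "nat set \<Rightarrow> nat \<Rightarrow> nat \<Rightarrow> bool" where
  "le_M S u u' \<longleftrightarrow> (\<exists>s\<in>S. u + s = u' \<and> ord_sg S u + ord_sg S s = ord_sg S u')"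

definition maxAp_M :: "nat set \<Rightarrow> nat \<Rightarrow> nat set" where
  "maxAp_M S m = {w \<in> apery_set S m. \<forall>w'\<in>apery_set S m. le_M S w w' \<longrightarrow> w' = w}"

definition apery_a :: "nat set \<Rightarrow> nat list \<Rightarrow> nat \<Rightarrow> int" where
  "apery_a S gs i = (THE a. int (apery_elem (blowup_semigroup gs) (hd gs) i) + a * int (hd gs)
                            = int (apery_elem S (hd gs) i))"

definition apery_b :: "nat set \<Rightarrow> nat list \<Rightarrow> nat \<Rightarrow> nat" where
  "apery_b S gs i = Max {l. apery_elem S (hd gs) i \<in> multM S l}"


section \<open>Numerical semigroup rings\<close>

text \<open>\<open>K[[t\<^sup>S]]\<close>: the subring of \<open>K[[t]]\<close> of all power series supported on \<open>S\<close>\<close>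
definition semigroup_ring :: "nat set \<Rightarrow> ('k::field) fps ring" where
  "semigroup_ring S =
    \<lparr> carrier = {f. \<forall>n. fps_nth f n \<noteq> 0 \<longrightarrow> n \<in> S}, mult = (*), one = 1, zero = 0, add = (+) \<rparr>"

definition semigroup_ring_max :: "nat set \<Rightarrow> nat list \<Rightarrow> ('k::field) fps set" where
  "semigroup_ring_max S gs = genideal (semigroup_ring S) ((\<lambda>g. fps_X ^ g) ` set gs)"

end

theory Submission
  imports Defs
begin

text \<open>
  The condition \<open>b\<^sub>i < a\<^sub>i\<close> says that \<open>\<omega>\<^sub>i + c g\<^sub>1\<close> has order greater than \<open>b\<^sub>i + c\<close> for some \<open>c\<close>:
  the initial form of \<open>t\<close> to the power \<open>\<omega>\<^sub>i\<close> is killed by a power of the initial form of \<open>t\<close> to the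
  power \<open>g\<^sub>1\<close>. As \<open>g\<^sub>1\<close> is the smallest generator, it is then killed by all homogeneous elements of
  large degree and lies in \<open>H\<^sup>0\<close>. By the Buchsbaum property the homogeneous maximal ideal kills it,
  that is, \<open>\<omega>\<^sub>i + s\<close> has order greater than \<open>b\<^sub>i\<close> plus the order of \<open>s\<close> for every nonzero \<open>s \<in> S\<close>,
  so nothing lies strictly above \<open>\<omega>\<^sub>i\<close>.
\<close>

section \<open>Associated graded rings\<close>


text \<open>Powers \<open>ideal_pow R I (Suc i)\<close> occur throughout as moduli of cosets, so the
  simplifier has to leave them folded instead of rewriting them to products.\<close>

declare Group.nat_pow_Suc [simp del]

context cring
begin

section \<open>Powers of an ideal and products of their cosets\<close>

lemma ideal_ideal_pow:
  assumes "ideal I R"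
  shows "ideal (ideal_pow R I n) R"
proof -
  interpret P: comm_monoid "ideals_set R"
    by (rule ideals_set_is_comm_monoid)
  have "I [^]\<^bsub>ideals_set R\<^esub> n \<in> carrier (ideals_set R)"
    by (rule P.nat_pow_closed) (simp add: ideals_set_def assms)
  then show ?thesis
    by (simp add: ideals_set_def)
qed

lemma ideal_pow_Suc:
  assumes "ideal I R"
  shows "ideal_pow R I (Suc n) = ideal_prod R (ideal_pow R I n) I"
  by (simp add: nat_pow_def ideals_set_def)

lemma ideal_pow_mult_closed:
  assumes "ideal I R" "a \<in> ideal_pow R I i" "b \<in> ideal_pow R I j"
  shows "a \<otimes> b \<in> ideal_pow R I (i + j)"
proof -
  interpret P: comm_monoid "ideals_set R"
    by (rule ideals_set_is_comm_monoid)
  have "ideal_pow R I (i + j) = ideal_prod R (ideal_pow R I i) (ideal_pow R I j)"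
    using P.nat_pow_mult[of I i j] assms(1) by (simp add: ideals_set_def)
  then show ?thesis
    using assms by (simp add: ideal_prod.prod)
qed

lemma ideal_pow_Suc_subset:
  assumes "ideal I R"
  shows "ideal_pow R I (Suc n) \<subseteq> ideal_pow R I n"
  using ideal_prod_inter[OF ideal_ideal_pow[OF assms] assms] ideal_pow_Suc[OF assms] by blast

lemma ideal_pow_carrier:
  assumes "ideal I R" "a \<in> ideal_pow R I n"
  shows "a \<in> carrier R"
  using ideal.Icarr[OF ideal_ideal_pow[OF assms(1)] assms(2)] .

lemma zero_mem_ideal_pow:
  assumes "ideal I R"
  shows "\<zero> \<in> ideal_pow R I n"
  using additive_subgroup.zero_closed[OF ideal.axioms(1)[OF ideal_ideal_pow[OF assms]]] .

lemma rcos_zero_ideal_pow: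
  assumes "ideal I R"
  shows "ideal_pow R I n +> \<zero> = ideal_pow R I n"
  using abelian_subgroup.a_rcos_const
    [OF abelian_subgroupI3[OF ideal.axioms(1)[OF ideal_ideal_pow[OF assms]] abelian_group_axioms]
      zero_mem_ideal_pow[OF assms]] .

text \<open>The factors are cosets of I^(i+1) and I^(j+1), not of the modulus, so independence of
  the representatives has to be checked: for h in I^(i+1) and l in I^(j+1) the products (h + a)(l +
  b) and ab differ by h(l + b) + al, which lies in I^(i+j+1).\<close>

lemma rcoset_mult_ideal_pow:
  assumes I: "ideal I R" and a: "a \<in> ideal_pow R I i" and b: "b \<in> ideal_pow R I j"
  shows "rcoset_mult R (ideal_pow R I (Suc (i + j)))
           (ideal_pow R I (Suc i) +> a) (ideal_pow R I (Suc j) +> b)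
         = ideal_pow R I (Suc (i + j)) +> (a \<otimes> b)"
proof -
  let ?L = "ideal_pow R I (Suc (i + j))"
  interpret L: ideal ?L R by (rule ideal_ideal_pow[OF I])
  note carr = ideal_pow_carrier[OF I]
  have eq: "?L +> (a' \<otimes> b') = ?L +> (a \<otimes> b)"
    if a': "a' \<in> ideal_pow R I (Suc i) +> a" and b': "b' \<in> ideal_pow R I (Suc j) +> b" for a' b'
  proof -
    from a' obtain h where h: "h \<in> ideal_pow R I (Suc i)" "a' = h \<oplus> a"
      by (auto simp: a_r_coset_def r_coset_def)
    from b' obtain l where l: "l \<in> ideal_pow R I (Suc j)" "b' = l \<oplus> b"
      by (auto simp: a_r_coset_def r_coset_def)
    note c = carr[OF a] carr[OF b] carr[OF h(1)] carr[OF l(1)]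
    have "h \<otimes> (l \<oplus> b) \<in> ?L"
    proof -
      have "l \<oplus> b \<in> ideal_pow R I j"
        using additive_subgroup.a_closed[OF ideal.axioms(1)[OF ideal_ideal_pow[OF I]]]
          l(1) b ideal_pow_Suc_subset[OF I] by blast
      from ideal_pow_mult_closed[OF I h(1) this] show ?thesis by simp
    qed
    moreover have "a \<otimes> l \<in> ?L"
      using ideal_pow_mult_closed[OF I a l(1)] by simp
    ultimately have "h \<otimes> (l \<oplus> b) \<oplus> a \<otimes> l \<in> ?L"
      by (rule L.a_closed)
    moreover have "a' \<otimes> b' = (h \<otimes> (l \<oplus> b) \<oplus> a \<otimes> l) \<oplus> a \<otimes> b"
      unfolding h(2) l(2) using c by algebra
    ultimately have "a' \<otimes> b' \<in> ?L +> (a \<otimes> b)"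
      by (auto simp: a_r_coset_def r_coset_def)
    then show ?thesis
      using L.a_repr_independence' c by simp
  qed
  \<comment> \<open>\<open>rcoset_mult\<close> is a union over all pairs of representatives; this
    family is constant, and nonemptiness of both cosets makes the union equal to its value.\<close>
  have ne: "a \<in> ideal_pow R I (Suc i) +> a" "b \<in> ideal_pow R I (Suc j) +> b"
    using ideal.axioms(1)[OF ideal_ideal_pow[OF I]] carr[OF a] carr[OF b]
      abelian_subgroup.a_rcos_self[OF abelian_subgroupI3[OF _ abelian_group_axioms]] by blast+
  show ?thesis
    unfolding rcoset_mult_def using eq ne by blast
qed

text \<open>Convolution sums are formed in R/I^(k+1); with J = I^(k+1) and H = I^k this keeps them
  inside I^k/I^(k+1). A sum over an infinite index set is zero by convention, which also lies in the
  image.\<close>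

lemma finsum_Quot_image:
  assumes J: "ideal J R" and H: "ideal H R" and f: "f \<in> A \<rightarrow> (+>) J ` H"
  shows "finsum (R Quot J) f A \<in> (+>) J ` H"
proof -
  interpret J: ideal J R by fact
  interpret Q: ring "R Quot J" by (rule J.quotient_is_ring)
  have sub: "(+>) J ` H \<subseteq> carrier (R Quot J)"
    using ideal.Icarr[OF H] by (auto simp: FactRing_simps)
  have z: "\<zero>\<^bsub>R Quot J\<^esub> \<in> (+>) J ` H"
    using additive_subgroup.zero_closed[OF ideal.axioms(1)[OF H]] J.a_rcos_const[OF J.zero_closed]
    by (auto simp: FactRing_def intro!: image_eqI[of _ _ \<zero>])
  show ?thesis
    using f
  proof (induction A rule: infinite_finite_induct)
    case (infinite A)
    then show ?case using z by simp
  next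
    case empty
    then show ?case using z by simp
  next
    case (insert x F)
    from insert obtain a b where "a \<in> H" "f x = J +> a" "b \<in> H" "finsum (R Quot J) f F = J +> b"
      by (auto simp: Pi_iff)
    moreover have "finsum (R Quot J) f (insert x F) = f x \<oplus>\<^bsub>R Quot J\<^esub> finsum (R Quot J) f F"
      using insert.hyps insert.prems sub by (intro Q.finsum_insert) (auto simp: Pi_iff)
    ultimately have "finsum (R Quot J) f (insert x F) = J +> (a \<oplus> b)"
      using ideal.Icarr[OF H] J.a_rcos_sum by (simp add: FactRing_def)
    moreover have "a \<oplus> b \<in> H"
      using additive_subgroup.a_closed[OF ideal.axioms(1)[OF H]] \<open>a \<in> H\<close> \<open>b \<in> H\<close> by blast
    ultimately show ?case by blast
  qed
qed

text \<open>The direct product of all I^i/I^(i+1); the graded ring consists of its elements of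
  finite support. Multiplication is studied one component at a time, so the lemmas below are phrased
  for this larger set.\<close>

definition graded_components :: "'a set \<Rightarrow> (nat \<Rightarrow> 'a set) set" where
  "graded_components I = {x. \<forall>i. x i \<in> (+>) (ideal_pow R I (Suc i)) ` ideal_pow R I i}"

text \<open>For \<open>a\<close> in I^d this is the initial form of \<open>a\<close> in degree
  \<open>d\<close>, which is zero if \<open>a\<close> even lies in I^(d+1). In the other degrees the
  entry I^(i+1) is the zero coset.\<close>

definition homogeneous :: "'a set \<Rightarrow> nat \<Rightarrow> 'a \<Rightarrow> nat \<Rightarrow> 'a set" where
  "homogeneous I d a i = (if i = d then ideal_pow R I (Suc d) +> a else ideal_pow R I (Suc i))"

lemma ideal_pow_Suc_mem_image:
  assumes "ideal I R"
  shows "ideal_pow R I (Suc i) \<in> (+>) (ideal_pow R I (Suc i)) ` ideal_pow R I i"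
  using rcos_zero_ideal_pow[OF assms] zero_mem_ideal_pow[OF assms] by (metis image_eqI)

lemma homogeneous_carrier:
  assumes I: "ideal I R" and a: "a \<in> ideal_pow R I d"
  shows "homogeneous I d a \<in> carrier (assoc_graded R I)"
proof -
  have "finite {i. homogeneous I d a i \<noteq> ideal_pow R I (Suc i)}"
    by (rule finite_subset[of _ "{d}"]) (auto simp: homogeneous_def)
  then show ?thesis
    using ideal_pow_Suc_mem_image[OF I] a by (auto simp: assoc_graded_def homogeneous_def)
qed

lemma carrier_assoc_graded_subset: "carrier (assoc_graded R I) \<subseteq> graded_components I"
  by (auto simp: assoc_graded_def graded_components_def)

section \<open>The convolution product\<close>

lemma rcoset_mult_image:
  assumes I: "ideal I R" and x: "x \<in> graded_components I" and y: "y \<in> graded_components I"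
    and "i \<le> k"
  shows "rcoset_mult R (ideal_pow R I (Suc k)) (x i) (y (k - i))
         \<in> (+>) (ideal_pow R I (Suc k)) ` ideal_pow R I k"
proof -
  from x obtain a where a: "a \<in> ideal_pow R I i" "x i = ideal_pow R I (Suc i) +> a"
    by (auto simp: graded_components_def)
  from y obtain b where b: "b \<in> ideal_pow R I (k - i)" "y (k - i) = ideal_pow R I (Suc (k - i)) +> b"
    by (auto simp: graded_components_def)
  show ?thesis
    using rcoset_mult_ideal_pow[OF I a(1) b(1)] ideal_pow_mult_closed[OF I a(1) b(1)] a(2) b(2) \<open>i \<le> k\<close>
    by auto
qed

lemma rcoset_mult_zero_left:
  assumes I: "ideal I R" and y: "y \<in> graded_components I" and "i \<le> k"
  shows "rcoset_mult R (ideal_pow R I (Suc k)) (ideal_pow R I (Suc i)) (y (k - i))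
         = ideal_pow R I (Suc k)"
proof -
  from y obtain b where b: "b \<in> ideal_pow R I (k - i)" "y (k - i) = ideal_pow R I (Suc (k - i)) +> b"
    by (auto simp: graded_components_def)
  show ?thesis
    using rcoset_mult_ideal_pow[OF I zero_mem_ideal_pow[OF I, of i] b(1)] b(2) \<open>i \<le> k\<close>
      rcos_zero_ideal_pow[OF I] ideal_pow_carrier[OF I b(1)] by simp
qed

lemma rcoset_mult_zero_right:
  assumes I: "ideal I R" and x: "x \<in> graded_components I"
  shows "rcoset_mult R (ideal_pow R I (Suc (i + j))) (x i) (ideal_pow R I (Suc j))
         = ideal_pow R I (Suc (i + j))"
proof -
  from x obtain a where a: "a \<in> ideal_pow R I i" "x i = ideal_pow R I (Suc i) +> a"
    by (auto simp: graded_components_def)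
  show ?thesis
    using rcoset_mult_ideal_pow[OF I a(1) zero_mem_ideal_pow[OF I, of j]] a(2)
      rcos_zero_ideal_pow[OF I] ideal_pow_carrier[OF I a(1)] by simp
qed

lemma assoc_graded_mult_components:
  assumes I: "ideal I R" and x: "x \<in> graded_components I" and y: "y \<in> graded_components I"
  shows "x \<otimes>\<^bsub>assoc_graded R I\<^esub> y \<in> graded_components I"
  unfolding graded_components_def assoc_graded_def
  by (auto intro!: finsum_Quot_image ideal_ideal_pow I rcoset_mult_image x y)

lemma assoc_graded_mult_zero:
  assumes I: "ideal I R"
    and "\<And>i. i \<le> k \<Longrightarrow> rcoset_mult R (ideal_pow R I (Suc k)) (x i) (y (k - i)) = ideal_pow R I (Suc k)"
  shows "(x \<otimes>\<^bsub>assoc_graded R I\<^esub> y) k = ideal_pow R I (Suc k)"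
proof -
  interpret Q: ring "R Quot ideal_pow R I (Suc k)"
    by (rule ideal.quotient_is_ring[OF ideal_ideal_pow[OF I]])
  have "finsum (R Quot ideal_pow R I (Suc k))
      (\<lambda>i. rcoset_mult R (ideal_pow R I (Suc k)) (x i) (y (k - i))) {..k}
      = \<zero>\<^bsub>R Quot ideal_pow R I (Suc k)\<^esub>"
    by (rule Q.add.finprod_one_eqI) (use assms(2) in \<open>simp add: FactRing_def\<close>)
  then show ?thesis
    by (simp add: assoc_graded_def FactRing_def)
qed

text \<open>In the convolution of degree d + j every summand with index other than \<open>d\<close>
  has a zero factor from the homogeneous element, so only the product of the two cosets in degrees d
  and j survives.\<close>

lemma homogeneous_mult:
  assumes I: "ideal I R" and a: "a \<in> ideal_pow R I d" and y: "y \<in> graded_components I"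
    and b: "b \<in> ideal_pow R I j" "y j = ideal_pow R I (Suc j) +> b"
  shows "(homogeneous I d a \<otimes>\<^bsub>assoc_graded R I\<^esub> y) (d + j) = ideal_pow R I (Suc (d + j)) +> (a \<otimes> b)"
proof -
  let ?k = "d + j"
  let ?f = "\<lambda>i. rcoset_mult R (ideal_pow R I (Suc ?k)) (homogeneous I d a i) (y (?k - i))"
  interpret Q: ring "R Quot ideal_pow R I (Suc ?k)"
    by (rule ideal.quotient_is_ring[OF ideal_ideal_pow[OF I]])
  have x: "homogeneous I d a \<in> graded_components I"
    using homogeneous_carrier[OF I a] carrier_assoc_graded_subset by blast
  have carr: "?f \<in> {..?k} \<rightarrow> carrier (R Quot ideal_pow R I (Suc ?k))"
  proof
    fix i assume "i \<in> {..?k}"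
    then have "?f i \<in> (+>) (ideal_pow R I (Suc ?k)) ` ideal_pow R I ?k"
      using rcoset_mult_image[OF I x y] by simp
    then show "?f i \<in> carrier (R Quot ideal_pow R I (Suc ?k))"
      using ideal_pow_carrier[OF I] by (auto simp: FactRing_simps)
  qed
  have "finsum (R Quot ideal_pow R I (Suc ?k)) ?f {..?k}
      = finsum (R Quot ideal_pow R I (Suc ?k)) ?f {d}"
    by (rule Q.add.finprod_mono_neutral_cong_right)
      (use carr rcoset_mult_zero_left[OF I y] in \<open>auto simp: homogeneous_def FactRing_def\<close>)
  also have "\<dots> = ?f d"
    using funcset_mem[OF carr, of d] by simp
  also have "\<dots> = ideal_pow R I (Suc ?k) +> (a \<otimes> b)"
    using rcoset_mult_ideal_pow[OF I a b(1)] b(2) by (simp add: homogeneous_def)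
  finally show ?thesis
    by (simp add: assoc_graded_def)
qed

text \<open>Induction on k: in degree i \<le> k a summand of the product of u in M^k and v in M has
  index l < k, where u vanishes, or l = i = k, where it contains the factor \<open>v 0\<close>,
  which vanishes too.\<close>

lemma graded_irrelevant_ideal_pow:
  assumes I: "ideal I R"
    and "y \<in> ideal_pow (assoc_graded R I) (graded_irrelevant_ideal R I) k"
  shows "y \<in> graded_components I \<and> (\<forall>i<k. y i = ideal_pow R I (Suc i))"
  using assms(2)
proof (induction k arbitrary: y)
  case 0
  then show ?case
    using carrier_assoc_graded_subset by (auto simp: ideals_set_def nat_pow_def)
next
  case (Suc k)
  from Suc.prems have "y \<in> ideal_prod (assoc_graded R I)
      (ideal_pow (assoc_graded R I) (graded_irrelevant_ideal R I) k) (graded_irrelevant_ideal R I)"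
    by (simp add: ideals_set_def nat_pow_def)
  then show ?case
  proof induction
    case (prod u v)
    note u = Suc.IH[OF prod(1)]
    have v: "v \<in> graded_components I" "v 0 = ideal_pow R I (Suc 0)"
      using prod(2) carrier_assoc_graded_subset
      by (auto simp: graded_irrelevant_ideal_def assoc_graded_def)
    have "(u \<otimes>\<^bsub>assoc_graded R I\<^esub> v) i = ideal_pow R I (Suc i)" if "i < Suc k" for i
    proof (rule assoc_graded_mult_zero[OF I])
      fix l assume "l \<le> i"
      show "rcoset_mult R (ideal_pow R I (Suc i)) (u l) (v (i - l)) = ideal_pow R I (Suc i)"
      proof (cases "l < k")
        case True
        then show ?thesis
          using rcoset_mult_zero_left[OF I v(1) \<open>l \<le> i\<close>] u by simp
      next
        case False
        with \<open>l \<le> i\<close> that have "i = l" by simp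
        then show ?thesis
          using rcoset_mult_zero_right[OF I, of u i 0] u v(2) by simp
      qed
    qed
    then show ?case
      using assoc_graded_mult_components[OF I] u v by blast
  next
    case (sum u v)
    have add: "(u \<oplus>\<^bsub>assoc_graded R I\<^esub> v) i = u i <+> v i" for i
      by (simp add: assoc_graded_def)
    have "u i <+> v i \<in> (+>) (ideal_pow R I (Suc i)) ` ideal_pow R I i" for i
    proof -
      from sum obtain a b where ab: "a \<in> ideal_pow R I i" "u i = ideal_pow R I (Suc i) +> a"
        "b \<in> ideal_pow R I i" "v i = ideal_pow R I (Suc i) +> b"
        unfolding graded_components_def by blast
      have "u i <+> v i = ideal_pow R I (Suc i) +> (a \<oplus> b)"
        using ideal.a_rcos_sum[OF ideal_ideal_pow[OF I]] ab ideal_pow_carrier[OF I] by simp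
      moreover have "a \<oplus> b \<in> ideal_pow R I i"
        using ab additive_subgroup.a_closed[OF ideal.axioms(1)[OF ideal_ideal_pow[OF I]]] by blast
      ultimately show ?thesis by blast
    qed
    moreover have "u i <+> v i = ideal_pow R I (Suc i)" if "i < Suc k" for i
      using sum that ideal.a_rcos_sum[OF ideal_ideal_pow[OF I], of \<zero> \<zero> "Suc i"]
      by (simp add: rcos_zero_ideal_pow[OF I])
    ultimately show ?case
      by (simp add: graded_components_def add)
  qed
qed

text \<open>Elements of M^(k+1) live in degrees above k, and \<open>ann\<close> says that the
  initial form of \<open>a\<close> kills everything in these degrees.\<close>

lemma homogeneous_in_local_cohomology0:
  assumes I: "ideal I R" and a: "a \<in> ideal_pow R I d"
    and ann: "\<And>j c. \<lbrakk>k \<le> j; c \<in> ideal_pow R I j\<rbrakk> \<Longrightarrow> a \<otimes> c \<in> ideal_pow R I (Suc (d + j))"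
  shows "homogeneous I d a \<in> local_cohomology0 (assoc_graded R I) (graded_irrelevant_ideal R I)"
proof -
  \<comment> \<open>The exponent is \<open>Suc k\<close> because the union defining H^0 starts at
    exponent 1, while \<open>k\<close> may be 0.\<close>
  have "homogeneous I d a \<otimes>\<^bsub>assoc_graded R I\<^esub> y = \<zero>\<^bsub>assoc_graded R I\<^esub>"
    if y: "y \<in> ideal_pow (assoc_graded R I) (graded_irrelevant_ideal R I) (Suc k)" for y
  proof
    fix n
    note yc = graded_irrelevant_ideal_pow[OF I y]
    have "(homogeneous I d a \<otimes>\<^bsub>assoc_graded R I\<^esub> y) n = ideal_pow R I (Suc n)"
    proof (cases "d \<le> n")
      case False
      then show ?thesis
        using rcoset_mult_zero_left[OF I] yc
        by (intro assoc_graded_mult_zero[OF I]) (auto simp: homogeneous_def)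
    next
      case True
      then obtain j where n: "n = d + j" using le_Suc_ex by blast
      \<comment> \<open>In degrees up to k the component of \<open>y\<close> is zero and is
        represented by 0, so \<open>ann\<close> is invoked only in degrees above k.\<close>
      obtain b where b: "b \<in> ideal_pow R I j" "y j = ideal_pow R I (Suc j) +> b"
        and bz: "j < Suc k \<longrightarrow> b = \<zero>"
      proof (cases "j < Suc k")
        case True
        then show ?thesis
          using that[of \<zero>] yc zero_mem_ideal_pow[OF I] rcos_zero_ideal_pow[OF I] by simp
      next
        case False
        from yc have "y j \<in> (+>) (ideal_pow R I (Suc j)) ` ideal_pow R I j"
          by (simp add: graded_components_def)
        with False that show ?thesis by blast
      qed
      have "a \<otimes> b \<in> ideal_pow R I (Suc n)"
        using bz ann[of j b] b(1) zero_mem_ideal_pow[OF I] ideal_pow_carrier[OF I a] n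
        by (cases "j < Suc k") auto
      then have "ideal_pow R I (Suc n) +> (a \<otimes> b) = ideal_pow R I (Suc n)"
        using abelian_subgroup.a_rcos_const[OF abelian_subgroupI3
            [OF ideal.axioms(1)[OF ideal_ideal_pow[OF I]] abelian_group_axioms]] by blast
      then show ?thesis
        using homogeneous_mult[OF I a, of y, OF _ b] yc n by simp
    qed
    then show "(homogeneous I d a \<otimes>\<^bsub>assoc_graded R I\<^esub> y) n = \<zero>\<^bsub>assoc_graded R I\<^esub> n"
      by (simp add: assoc_graded_def)
  qed
  then have "homogeneous I d a \<in> annihilator (assoc_graded R I)
      (ideal_pow (assoc_graded R I) (graded_irrelevant_ideal R I) (Suc k))"
    using homogeneous_carrier[OF I a] by (simp add: annihilator_def)
  then show ?thesis
    unfolding local_cohomology0_def by (intro UN_I[of "Suc k"]) simp_all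
qed

text \<open>The initial form of \<open>b\<close> has positive degree and so lies in M, and that of
  \<open>a\<close> lies in H^0. Their product belongs to M H^0 = 0, and its component of degree e +
  d is the class of ba.\<close>

lemma assoc_graded_buchsbaumD:
  assumes I: "ideal I R" and B: "assoc_graded_buchsbaum R I"
    and a: "a \<in> ideal_pow R I d"
    and ann: "\<And>j c. \<lbrakk>k \<le> j; c \<in> ideal_pow R I j\<rbrakk> \<Longrightarrow> a \<otimes> c \<in> ideal_pow R I (Suc (d + j))"
    and b: "b \<in> ideal_pow R I e" "e \<noteq> 0"
  shows "b \<otimes> a \<in> ideal_pow R I (Suc (e + d))"
proof -
  have "homogeneous I e b \<in> graded_irrelevant_ideal R I"
    using homogeneous_carrier[OF I b(1)] b(2)
    by (simp add: graded_irrelevant_ideal_def homogeneous_def assoc_graded_def)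
  from ideal_prod.prod[OF this homogeneous_in_local_cohomology0[OF I a ann]]
  have "homogeneous I e b \<otimes>\<^bsub>assoc_graded R I\<^esub> homogeneous I d a = \<zero>\<^bsub>assoc_graded R I\<^esub>"
    using B unfolding assoc_graded_buchsbaum_def by blast
  then have "(homogeneous I e b \<otimes>\<^bsub>assoc_graded R I\<^esub> homogeneous I d a) (e + d)
      = ideal_pow R I (Suc (e + d))"
    by (simp add: assoc_graded_def)
  moreover have "homogeneous I d a \<in> graded_components I"
    using homogeneous_carrier[OF I a] carrier_assoc_graded_subset by blast
  ultimately have "ideal_pow R I (Suc (e + d)) +> (b \<otimes> a) = ideal_pow R I (Suc (e + d))"
    using homogeneous_mult[OF I b(1) _ a] by (simp add: homogeneous_def)
  then show ?thesis
    using ideal.rcos_const_imp_mem[OF ideal_ideal_pow[OF I]]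
      ideal_pow_carrier[OF I a] ideal_pow_carrier[OF I b(1)] by simp
qed

end

section \<open>Numerical semigroups\<close>

lemma submonoid_gen_base: "a \<in> A \<Longrightarrow> a \<in> submonoid_gen A"
  using submonoid_gen.add[OF _ submonoid_gen.zero] by fastforce

lemma submonoid_gen_add:
  "u \<in> submonoid_gen A \<Longrightarrow> v \<in> submonoid_gen A \<Longrightarrow> u + v \<in> submonoid_gen A"
  by (induction rule: submonoid_gen.induct) (auto simp: add.assoc intro: submonoid_gen.add)

lemma submonoid_gen_mult: "u \<in> submonoid_gen A \<Longrightarrow> n * u \<in> submonoid_gen A"
  by (induction n) (auto intro: submonoid_gen.zero submonoid_gen_add)

lemma submonoid_gen_mono:
  assumes "A \<subseteq> submonoid_gen B"
  shows "submonoid_gen A \<subseteq> submonoid_gen B"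
proof
  fix u assume "u \<in> submonoid_gen A"
  then show "u \<in> submonoid_gen B"
    by induction (use assms in \<open>auto intro: submonoid_gen.zero submonoid_gen_add\<close>)
qed

lemma submonoid_gen_cases_pos:
  assumes "u \<in> submonoid_gen A" "u \<noteq> 0"
  obtains a v where "a \<in> A" "v \<in> submonoid_gen A" "u = a + v"
  using assms by (auto elim: submonoid_gen.cases)

lemma sum_list_mem_submonoid_gen: "set xs \<subseteq> submonoid_gen A \<Longrightarrow> sum_list xs \<in> submonoid_gen A"
  by (induction xs) (auto intro: submonoid_gen.zero submonoid_gen_add)

text \<open>Bezout's identity, used modulo m: a coefficient -y is replaced by the congruent (m - 1)
  y, so that the combination stays in the submonoid. For gcd 1 this leads to elements in every
  residue class.\<close>

lemma submonoid_gen_Gcd_cong: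
  fixes m :: nat
  assumes "finite A" "m \<noteq> 0"
  shows "\<exists>s\<in>submonoid_gen A. s mod m = Gcd A mod m"
  using assms(1)
proof (induction A)
  case empty
  then show ?case by (auto intro: bexI[of _ 0] submonoid_gen.zero)
next
  case (insert a A)
  then obtain s where s: "s \<in> submonoid_gen A" "s mod m = Gcd A mod m" by blast
  have mem: "x * a + y * s \<in> submonoid_gen (insert a A)" for x y
    using s(1) submonoid_gen_mono[of A "insert a A"] submonoid_gen_base
    by (intro submonoid_gen_add submonoid_gen_mult) (auto intro: submonoid_gen_base)
  have "\<exists>x y. (x * a + y * Gcd A) mod m = gcd a (Gcd A) mod m"
  proof (cases "a = 0")
    case True
    then show ?thesis by (intro exI[of _ 0] exI[of _ 1]) simp
  next
    case False
    obtain x y where "a * x = Gcd A * y + gcd a (Gcd A)"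
      using bezout_nat[OF False] by blast
    then have *: "x * a + (m - 1) * y * Gcd A = gcd a (Gcd A) + (1 + (m - 1)) * (y * Gcd A)"
      by (simp add: algebra_simps)
    have "x * a + (m - 1) * y * Gcd A = gcd a (Gcd A) + m * (y * Gcd A)"
      using * \<open>m \<noteq> 0\<close> by simp
    then show ?thesis by (metis mod_mult_self2)
  qed
  then obtain x y where "(x * a + y * Gcd A) mod m = gcd a (Gcd A) mod m" by blast
  then have "(x * a + y * s) mod m = gcd a (Gcd A) mod m"
    using s(2) by (metis mod_add_cong mod_mult_cong)
  then show ?case using mem by (metis Gcd_insert)
qed

section \<open>The sets \<open>hM\<close> and the order function\<close>

lemma multM_0: "s \<in> multM S 0 \<longleftrightarrow> s \<in> S"
  by (simp add: multM_def)

text \<open>A nonzero element of the semigroup contains a generator, so one generator is split off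
  each summand and the remainders are collected in \<open>u\<close>. Conversely, for h > 0,
  \<open>u\<close> is absorbed into the first generator; for h = 0 the claim is the convention 0M =
  S.\<close>

lemma multM_iff:
  assumes "0 \<notin> A"
  shows "s \<in> multM (submonoid_gen A) h \<longleftrightarrow>
    (\<exists>xs u. length xs = h \<and> set xs \<subseteq> A \<and> u \<in> submonoid_gen A \<and> s = sum_list xs + u)"
proof (cases h)
  case 0
  then show ?thesis by (simp add: multM_def)
next
  case (Suc n)
  show ?thesis
  proof
    assume "s \<in> multM (submonoid_gen A) h"
    then obtain ys where "length ys = h" "set ys \<subseteq> submonoid_gen A - {0}" "s = sum_list ys"
      using Suc by (auto simp: multM_def)
    moreover have "set ys \<subseteq> submonoid_gen A - {0} \<Longrightarrow> \<exists>xs u. length xs = length ys \<and> set xs \<subseteq> A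
        \<and> u \<in> submonoid_gen A \<and> sum_list ys = sum_list xs + u"
    proof (induction ys)
      case Nil
      then show ?case by (auto intro: submonoid_gen.zero)
    next
      case (Cons y ys)
      then obtain xs u where xs: "length xs = length ys" "set xs \<subseteq> A" "u \<in> submonoid_gen A"
        "sum_list ys = sum_list xs + u" by auto
      from Cons.prems obtain a v where "a \<in> A" "v \<in> submonoid_gen A" "y = a + v"
        by (auto elim: submonoid_gen_cases_pos)
      with xs show ?case
        by (intro exI[of _ "a # xs"] exI[of _ "v + u"]) (auto intro: submonoid_gen_add)
    qed
    ultimately show "\<exists>xs u. length xs = h \<and> set xs \<subseteq> A \<and> u \<in> submonoid_gen A \<and> s = sum_list xs + u"
      by blast
  next
    assume "\<exists>xs u. length xs = h \<and> set xs \<subseteq> A \<and> u \<in> submonoid_gen A \<and> s = sum_list xs + u"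
    then obtain x xs u where xs: "length xs = n" "set (x # xs) \<subseteq> A" "u \<in> submonoid_gen A"
      "s = x + sum_list xs + u"
      using Suc by (auto simp: length_Suc_conv)
    have sub: "A \<subseteq> submonoid_gen A - {0}"
      using assms submonoid_gen_base by auto
    have "x + u \<in> submonoid_gen A - {0}"
      using xs sub by (auto intro: submonoid_gen_add)
    then show "s \<in> multM (submonoid_gen A) h"
      using xs sub Suc by (auto simp: multM_def intro!: exI[of _ "(x + u) # xs"])
  qed
qed

context
  fixes A :: "nat set"
  assumes A: "0 \<notin> A"
begin

lemma multM_add:
  assumes "u \<in> multM (submonoid_gen A) i" "v \<in> multM (submonoid_gen A) j"
  shows "u + v \<in> multM (submonoid_gen A) (i + j)"
proof -
  from assms obtain xs s ys t where "length xs = i" "set xs \<subseteq> A" "s \<in> submonoid_gen A"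
    "u = sum_list xs + s" "length ys = j" "set ys \<subseteq> A" "t \<in> submonoid_gen A" "v = sum_list ys + t"
    unfolding multM_iff[OF A] by blast
  then show ?thesis
    unfolding multM_iff[OF A]
    by (intro exI[of _ "xs @ ys"] exI[of _ "s + t"]) (auto intro: submonoid_gen_add)
qed

text \<open>The surplus generators of a decomposition of length j are moved into the
  remainder.\<close>

lemma multM_antimono:
  assumes "i \<le> j"
  shows "multM (submonoid_gen A) j \<subseteq> multM (submonoid_gen A) i"
proof
  fix s assume "s \<in> multM (submonoid_gen A) j"
  then obtain xs u where xs: "length xs = j" "set xs \<subseteq> A" "u \<in> submonoid_gen A" "s = sum_list xs + u"
    unfolding multM_iff[OF A] by blast
  have "sum_list (drop i xs) \<in> submonoid_gen A"
    using xs(2) set_drop_subset[of i xs]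
    by (intro sum_list_mem_submonoid_gen subsetI submonoid_gen_base) blast
  moreover have "s = sum_list (take i xs) + (sum_list (drop i xs) + u)"
    unfolding xs(4) by (metis append_take_drop_id sum_list_append add.assoc)
  moreover have "set (take i xs) \<subseteq> A" "length (take i xs) = i"
    using xs(1,2) assms set_take_subset[of i xs] by auto
  ultimately show "s \<in> multM (submonoid_gen A) i"
    unfolding multM_iff[OF A] using submonoid_gen_add xs(3) by blast
qed

lemma multM_subset: "multM (submonoid_gen A) i \<subseteq> submonoid_gen A"
  using multM_antimono[of 0 i] by (auto simp: multM_0)

lemma multM_mult:
  assumes "g \<in> A"
  shows "n * g \<in> multM (submonoid_gen A) n"
  unfolding multM_iff[OF A] using assms
  by (intro exI[of _ "replicate n g"] exI[of _ 0])
    (auto intro: submonoid_gen.zero simp: sum_list_replicate)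

text \<open>Every generator is at least 1. The bound makes the set of all h with s in hM finite, so
  that it has a maximum.\<close>

lemma multM_le:
  assumes "s \<in> multM (submonoid_gen A) h"
  shows "h \<le> s"
proof -
  from assms obtain xs u where xs: "length xs = h" "set xs \<subseteq> A" "s = sum_list xs + u"
    unfolding multM_iff[OF A] by blast
  have "length xs \<le> sum_list xs"
    using xs(2)
  proof (induction xs)
    case (Cons x xs)
    then have "x \<noteq> 0" using A by (cases "x = 0") auto
    with Cons show ?case by simp
  qed simp
  with xs show ?thesis by simp
qed

lemma Max_multM:
  assumes "s \<in> submonoid_gen A"
  defines "b \<equiv> Max {l. s \<in> multM (submonoid_gen A) l}"
  shows "s \<in> multM (submonoid_gen A) b" "s \<notin> multM (submonoid_gen A) (Suc b)"
proof -
  have fin: "finite {l. s \<in> multM (submonoid_gen A) l}"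
    by (rule finite_subset[of _ "{..s}"]) (auto dest: multM_le)
  have "0 \<in> {l. s \<in> multM (submonoid_gen A) l}"
    using assms by (simp add: multM_0)
  with Max_in[OF fin] show "s \<in> multM (submonoid_gen A) b"
    unfolding b_def by blast
  show "s \<notin> multM (submonoid_gen A) (Suc b)"
    using Max_ge[OF fin, of "Suc b"] unfolding b_def[symmetric] by auto
qed

text \<open>Since the sets hM decrease, \<open>s\<close> drops out at only one h; this justifies the
  definite description in \<open>ord_sg\<close>.\<close>

lemma ord_sg_eqI:
  assumes "s \<in> multM (submonoid_gen A) h" "s \<notin> multM (submonoid_gen A) (Suc h)"
  shows "ord_sg (submonoid_gen A) s = h"
  unfolding ord_sg_def
proof (rule the_equality)
  fix l assume l: "s \<in> multM (submonoid_gen A) l \<and> s \<notin> multM (submonoid_gen A) (Suc l)"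
  show "l = h"
  proof (cases l h rule: linorder_cases)
    case less
    then show ?thesis
      using multM_antimono[of "Suc l" h] l assms(1) by auto
  next
    case greater
    then show ?thesis
      using multM_antimono[of "Suc h" l] l assms(2) by auto
  qed
qed (use assms in simp)

lemma ord_sg_mem:
  assumes "s \<in> submonoid_gen A"
  shows "s \<in> multM (submonoid_gen A) (ord_sg (submonoid_gen A) s)"
    "s \<notin> multM (submonoid_gen A) (Suc (ord_sg (submonoid_gen A) s))"
  using Max_multM[OF assms] ord_sg_eqI by metis+

text \<open>
  Among sufficiently many generators some \<open>g\<close> occurs \<open>c m\<close> times, and \<open>c m\<close> copies of \<open>g\<close> can be
  traded for \<open>c g \<ge> c m\<close> copies of \<open>m\<close>.
\<close>
lemma eventually_order_increases:
  assumes fin: "finite A" and m: "m \<in> A" "\<And>g. g \<in> A \<Longrightarrow> m \<le> g"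
    and w: "w + c * m \<in> multM (submonoid_gen A) (Suc (b + c))"
    and j: "card A * (c * m) < j" and s: "s \<in> multM (submonoid_gen A) j"
  shows "w + s \<in> multM (submonoid_gen A) (Suc (b + j))"
proof -
  from s obtain xs u where xs: "length xs = j" "set xs \<subseteq> A" "u \<in> submonoid_gen A" "s = sum_list xs + u"
    unfolding multM_iff[OF A] by blast
  \<comment> \<open>Pigeonhole: if every generator occurred at most c m times, the list would have
    length at most \<open>card A * (c * m)\<close>, which is less than j.\<close>
  obtain g where g: "g \<in> set xs" "c * m \<le> count_list xs g"
  proof (rule ccontr)
    assume "\<not> thesis"
    then have "\<forall>g\<in>set xs. count_list xs g \<le> c * m"
      using that by (meson nle_le)
    then have "length xs \<le> card (set xs) * (c * m)"
      using sum_bounded_above[of "set xs" "count_list xs" "c * m"] by (simp add: sum_count_set)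
    also have "\<dots> \<le> card A * (c * m)"
      using card_mono[OF fin xs(2)] by simp
    finally show False using j xs(1) by simp
  qed
  \<comment> \<open>Removal of k copies of \<open>g\<close> from the list; k varies in the induction
    because it drops with each copy removed.\<close>
  have "\<exists>ys. length ys + k = length xs \<and> set ys \<subseteq> A \<and> sum_list xs = k * g + sum_list ys"
    if "k \<le> count_list xs g" for k
    using that xs(2)
  proof (induction xs arbitrary: k)
    case (Cons x xs)
    show ?case
    proof (cases "x = g \<and> k \<noteq> 0")
      case True
      then obtain k' where k: "k = Suc k'" using not0_implies_Suc by blast
      from True Cons k obtain ys where "length ys + k' = length xs" "set ys \<subseteq> A"
        "sum_list xs = k' * g + sum_list ys" by force
      with True k show ?thesis by (intro exI[of _ ys]) auto
    next
      case False
      with Cons.prems have "k \<le> count_list xs g" by (auto split: if_splits)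
      moreover have "set xs \<subseteq> A" using Cons.prems by simp
      ultimately obtain ys where "length ys + k = length xs" "set ys \<subseteq> A"
        "sum_list xs = k * g + sum_list ys" using Cons.IH by blast
      with Cons.prems show ?thesis by (intro exI[of _ "x # ys"]) auto
    qed
  qed simp
  from this[OF g(2)] obtain ys where ys: "length ys + c * m = j" "set ys \<subseteq> A"
    "sum_list xs = c * m * g + sum_list ys" using xs(1) by blast
  have "g \<in> A" using g xs by blast
  have gm: "m \<le> g" "m \<noteq> 0" using m \<open>g \<in> A\<close> A by (auto intro: ccontr)
  have "sum_list ys + u \<in> multM (submonoid_gen A) (length ys)"
    unfolding multM_iff[OF A] using ys xs by blast
  \<comment> \<open>The c m copies of g have the sum c g m. Of the c g copies of m in it, c raise w
    to order at least b + c + 1 and the other c (g - 1) count one each. With the j - c m untouched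
    generators this gives order at least 1 + b + c g + j - c m, and g \<ge> m.\<close>
  from multM_add[OF multM_add[OF w multM_mult[OF m(1), of "c * (g - 1)"]] this]
  have "w + c * m + c * (g - 1) * m + (sum_list ys + u)
      \<in> multM (submonoid_gen A) (Suc (b + c) + c * (g - 1) + length ys)" .
  moreover have c: "c + c * (g - 1) = c * g"
    using gm by (cases g) auto
  moreover have "w + c * m + c * (g - 1) * m = w + c * m * g"
    unfolding add.assoc add_mult_distrib[symmetric] c by (simp add: ac_simps)
  ultimately have "w + s \<in> multM (submonoid_gen A) (Suc (b + c * g + length ys))"
    unfolding xs(4) ys(3) by (metis add_Suc add.assoc)
  moreover have "Suc (b + j) \<le> Suc (b + c * g + length ys)"
    using ys(1) mult_le_mono2[OF gm(1), of c] by linarith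
  ultimately show ?thesis
    using multM_antimono by blast
qed

end

section \<open>Numerical semigroup rings\<close>

lemma fps_mult_nth_nonzero:
  fixes f g :: "'k::field fps"
  assumes "fps_nth (f * g) n \<noteq> 0"
  obtains i j where "fps_nth f i \<noteq> 0" "fps_nth g j \<noteq> 0" "n = i + j"
proof -
  from assms obtain i where "i \<in> {0..n}" "fps_nth f i * fps_nth g (n - i) \<noteq> 0"
    unfolding fps_mult_nth by (meson sum.neutral)
  then show ?thesis
    using that[of i "n - i"] by auto
qed

lemma cring_semigroup_ring: "cring (semigroup_ring (submonoid_gen A) :: 'k::field fps ring)"
proof (rule cringI)
  show "abelian_group (semigroup_ring (submonoid_gen A) :: 'k fps ring)"
  proof (rule abelian_groupI)
    fix x assume "x \<in> carrier (semigroup_ring (submonoid_gen A) :: 'k fps ring)"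
    then show "\<exists>y\<in>carrier (semigroup_ring (submonoid_gen A)).
        y \<oplus>\<^bsub>semigroup_ring (submonoid_gen A)\<^esub> x = \<zero>\<^bsub>semigroup_ring (submonoid_gen A)\<^esub>"
      by (intro bexI[of _ "- x"]) (auto simp: semigroup_ring_def)
  qed (auto simp: semigroup_ring_def add.assoc add.commute, force)
  show "comm_monoid (semigroup_ring (submonoid_gen A) :: 'k fps ring)"
  proof (rule comm_monoidI)
    fix x y assume "x \<in> carrier (semigroup_ring (submonoid_gen A) :: 'k fps ring)"
      "y \<in> carrier (semigroup_ring (submonoid_gen A) :: 'k fps ring)"
    then show "x \<otimes>\<^bsub>semigroup_ring (submonoid_gen A)\<^esub> y \<in> carrier (semigroup_ring (submonoid_gen A))"
      by (auto simp: semigroup_ring_def elim!: fps_mult_nth_nonzero intro: submonoid_gen_add)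
  qed (auto simp: semigroup_ring_def mult.assoc mult.commute intro: submonoid_gen.zero split: if_splits)
qed (simp add: semigroup_ring_def distrib_right)

lemma a_inv_semigroup_ring:
  fixes f :: "'k::field fps"
  assumes "f \<in> carrier (semigroup_ring (submonoid_gen A))"
  shows "\<ominus>\<^bsub>semigroup_ring (submonoid_gen A)\<^esub> f = - f"
proof -
  interpret cring "semigroup_ring (submonoid_gen A) :: 'k fps ring"
    by (rule cring_semigroup_ring)
  show ?thesis
    by (rule minus_equality) (use assms in \<open>auto simp: semigroup_ring_def\<close>)
qed

section \<open>Series with support in \<open>hM\<close>, which will be the powers of the maximal
  ideal\<close>

definition supported :: "nat set \<Rightarrow> 'k::field fps set" where
  "supported T = {f. \<forall>n. fps_nth f n \<noteq> 0 \<longrightarrow> n \<in> T}"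

lemma carrier_semigroup_ring: "carrier (semigroup_ring S) = supported S"
  by (simp add: semigroup_ring_def supported_def)

context
  fixes A :: "nat set"
  assumes A: "0 \<notin> A"
begin

lemma supported_mult:
  assumes "f \<in> supported (multM (submonoid_gen A) i)" "g \<in> supported (multM (submonoid_gen A) j)"
  shows "f * g \<in> supported (multM (submonoid_gen A) (i + j))"
  using assms multM_add[OF A] by (auto simp: supported_def elim!: fps_mult_nth_nonzero)

text \<open>\<open>hM\<close> absorbs S because 0M = S and iM + jM lies in (i+j)M; supports of
  products behave accordingly.\<close>

lemma ideal_supported:
  "ideal (supported (multM (submonoid_gen A) h)) (semigroup_ring (submonoid_gen A) :: 'k::field fps ring)"
proof (rule idealI)
  interpret cring "semigroup_ring (submonoid_gen A) :: 'k fps ring"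
    by (rule cring_semigroup_ring)
  have sub: "supported (multM (submonoid_gen A) h) \<subseteq> carrier (semigroup_ring (submonoid_gen A) :: 'k fps ring)"
    using multM_subset[OF A] by (auto simp: carrier_semigroup_ring supported_def)
  show "ring (semigroup_ring (submonoid_gen A) :: 'k fps ring)" ..
  show "subgroup (supported (multM (submonoid_gen A) h))
      (add_monoid (semigroup_ring (submonoid_gen A) :: 'k fps ring))"
  proof (rule add.subgroupI)
    show "supported (multM (submonoid_gen A) h) \<subseteq> carrier (semigroup_ring (submonoid_gen A) :: 'k fps ring)"
      by (rule sub)
    have "0 \<in> supported (multM (submonoid_gen A) h)"
      by (simp add: supported_def)
    then show "supported (multM (submonoid_gen A) h) \<noteq> {}" by blast
  next
    fix a :: "'k fps" assume a: "a \<in> supported (multM (submonoid_gen A) h)"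
    then have "- a \<in> supported (multM (submonoid_gen A) h)"
      by (simp add: supported_def)
    then show "\<ominus>\<^bsub>semigroup_ring (submonoid_gen A)\<^esub> a \<in> supported (multM (submonoid_gen A) h)"
      using a_inv_semigroup_ring a sub by (metis subsetD)
  next
    fix a b :: "'k fps"
    assume "a \<in> supported (multM (submonoid_gen A) h)" "b \<in> supported (multM (submonoid_gen A) h)"
    then show "a \<oplus>\<^bsub>semigroup_ring (submonoid_gen A)\<^esub> b \<in> supported (multM (submonoid_gen A) h)"
      by (simp add: supported_def semigroup_ring_def) (metis add.right_neutral)
  qed
  fix a x :: "'k fps"
  assume "a \<in> supported (multM (submonoid_gen A) h)" "x \<in> carrier (semigroup_ring (submonoid_gen A))"
  then have "a * x \<in> supported (multM (submonoid_gen A) h)"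
    using supported_mult[of a h x 0] by (simp add: carrier_semigroup_ring multM_def)
  then show "x \<otimes>\<^bsub>semigroup_ring (submonoid_gen A)\<^esub> a \<in> supported (multM (submonoid_gen A) h)"
    "a \<otimes>\<^bsub>semigroup_ring (submonoid_gen A)\<^esub> x \<in> supported (multM (submonoid_gen A) h)"
    by (simp_all add: semigroup_ring_def mult.commute)
qed

end

text \<open>The part of f supported on e + S is t^e times a series in the ring, and the rest is
  supported on the remaining translates. Finiteness of E makes this a finite sum of elements of
  J.\<close>

lemma supported_subset_ideal:
  fixes J :: "'k::field fps set"
  assumes J: "ideal J (semigroup_ring (submonoid_gen A))"
    and E: "finite E" "\<And>e. e \<in> E \<Longrightarrow> fps_X ^ e \<in> J"
    and f: "f \<in> supported {e + u | e u. e \<in> E \<and> u \<in> submonoid_gen A}"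
  shows "f \<in> J"
  using E f
proof (induction E arbitrary: f)
  case empty
  then have "f = 0" by (auto simp: supported_def fps_eq_iff)
  moreover have "\<zero>\<^bsub>semigroup_ring (submonoid_gen A)\<^esub> \<in> J"
    by (rule additive_subgroup.zero_closed[OF ideal.axioms(1)[OF J]])
  ultimately show ?case by (simp add: semigroup_ring_def)
next
  case (insert e E)
  \<comment> \<open>\<open>g\<close> is f restricted to e + S and shifted down by e. Translates may
    overlap; the overlap goes to the exponent treated first.\<close>
  define g where "g = Abs_fps (\<lambda>n. if n \<in> submonoid_gen A then fps_nth f (e + n) else 0)"
  have g: "g \<in> carrier (semigroup_ring (submonoid_gen A))"
    by (simp add: g_def semigroup_ring_def)
  have nth: "fps_nth (fps_X ^ e * g) n
      = (if \<exists>u\<in>submonoid_gen A. n = e + u then fps_nth f n else 0)" for n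
    by (auto simp: fps_X_power_mult_nth g_def)
  have "f - fps_X ^ e * g \<in> supported {e + u | e u. e \<in> E \<and> u \<in> submonoid_gen A}"
    unfolding supported_def
  proof clarify
    fix n assume n: "fps_nth (f - fps_X ^ e * g) n \<noteq> 0"
    then have "fps_nth f n \<noteq> 0" "\<not> (\<exists>u\<in>submonoid_gen A. n = e + u)"
      by (auto simp: nth split: if_splits)
    moreover from this obtain e' u where "n = e' + u" "e' \<in> insert e E" "u \<in> submonoid_gen A"
      using insert.prems(2) unfolding supported_def by blast
    ultimately show "\<exists>e u. n = e + u \<and> e \<in> E \<and> u \<in> submonoid_gen A"
      by blast
  qed
  then have "f - fps_X ^ e * g \<in> J"
    using insert by blast
  moreover have "fps_X ^ e * g \<in> J"
    using ideal.I_r_closed[OF J insert.prems(1)[of e] g] by (simp add: semigroup_ring_def)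
  ultimately have "(f - fps_X ^ e * g) \<oplus>\<^bsub>semigroup_ring (submonoid_gen A)\<^esub> fps_X ^ e * g \<in> J"
    by (rule additive_subgroup.a_closed[OF ideal.axioms(1)[OF J]])
  then show ?case by (simp add: semigroup_ring_def)
qed

lemma fps_X_power_supported_iff: "fps_X ^ n \<in> (supported T :: 'k::field fps set) \<longleftrightarrow> n \<in> T"
  by (auto simp: supported_def fps_X_power_nth)

lemma ideal_semigroup_ring_max:
  assumes S: "S = submonoid_gen (set gs)"
  shows "ideal (semigroup_ring_max S gs) (semigroup_ring S :: 'k::field fps ring)"
    and "g \<in> set gs \<Longrightarrow> fps_X ^ g \<in> (semigroup_ring_max S gs :: 'k::field fps set)"
proof -
  interpret cring "semigroup_ring S :: 'k fps ring"
    unfolding S by (rule cring_semigroup_ring)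
  have sub: "(\<lambda>g. fps_X ^ g) ` set gs \<subseteq> carrier (semigroup_ring S :: 'k fps ring)"
    using submonoid_gen_base by (auto simp: S carrier_semigroup_ring fps_X_power_supported_iff)
  show "ideal (semigroup_ring_max S gs) (semigroup_ring S :: 'k::field fps ring)"
    unfolding semigroup_ring_max_def by (rule genideal_ideal[OF sub])
  show "g \<in> set gs \<Longrightarrow> fps_X ^ g \<in> (semigroup_ring_max S gs :: 'k::field fps set)"
    unfolding semigroup_ring_max_def using genideal_self[OF sub] by blast
qed

text \<open>One inclusion follows since supports add under multiplication. For the other, hM = E + S
  with E the finite set of h-fold sums of generators, and t^e for e in E is a product of h
  generators of the maximal ideal.\<close>

lemma ideal_pow_semigroup_ring_max:
  assumes S: "S = submonoid_gen (set gs)" and A: "0 \<notin> set gs"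
  shows "ideal_pow (semigroup_ring S :: 'k::field fps ring) (semigroup_ring_max S gs) h
         = supported (multM S h)"
proof
  let ?R = "semigroup_ring S :: 'k fps ring" and ?m = "semigroup_ring_max S gs :: 'k fps set"
  interpret cring ?R
    unfolding S by (rule cring_semigroup_ring)
  note m = ideal_semigroup_ring_max[OF S, where 'k = 'k]
  have "?m \<subseteq> supported (multM S 1)"
    unfolding semigroup_ring_max_def
  proof (rule genideal_minimal)
    show "ideal (supported (multM S 1)) ?R"
      unfolding S by (rule ideal_supported[OF A])
    show "(\<lambda>g. fps_X ^ g) ` set gs \<subseteq> supported (multM S 1)"
      using multM_mult[OF A, of _ 1] by (auto simp: S fps_X_power_supported_iff)
  qed
  then show "ideal_pow ?R ?m h \<subseteq> supported (multM S h)"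
  proof (induction h)
    case 0
    then show ?case by (simp add: nat_pow_def ideals_set_def carrier_semigroup_ring multM_def)
  next
    case (Suc h)
    show ?case
    proof
      fix f assume "f \<in> ideal_pow ?R ?m (Suc h)"
      then have "f \<in> ideal_prod ?R (ideal_pow ?R ?m h) ?m"
        by (simp add: ideal_pow_Suc[OF m(1)])
      then show "f \<in> supported (multM S (Suc h))"
      proof induction
        case (prod f g)
        then have "f * g \<in> supported (multM S (h + 1))"
          using Suc supported_mult[OF A] unfolding S by blast
        then show ?case by (simp add: semigroup_ring_def)
      next
        case (sum f g)
        then show ?case
          using additive_subgroup.a_closed[OF ideal.axioms(1)[OF ideal_supported[OF A]]]
          unfolding S by blast
      qed
    qed
  qed
  define E where "E = sum_list ` {xs. set xs \<subseteq> set gs \<and> length xs = h}"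
  have "fps_X ^ sum_list xs \<in> ideal_pow ?R ?m (length xs)" if "set xs \<subseteq> set gs" for xs
    using that
  proof (induction xs)
    case Nil
    then show ?case
      by (simp add: nat_pow_def ideals_set_def carrier_semigroup_ring supported_def S submonoid_gen.zero)
  next
    case (Cons x xs)
    then have "fps_X ^ sum_list xs \<otimes>\<^bsub>?R\<^esub> fps_X ^ x \<in> ideal_pow ?R ?m (length (x # xs))"
      using m(2) by (simp add: ideal_pow_Suc[OF m(1)] ideal_prod.prod)
    then show ?case by (simp add: semigroup_ring_def power_add mult.commute)
  qed
  then have "fps_X ^ e \<in> ideal_pow ?R ?m h" if "e \<in> E" for e
    using that by (auto simp: E_def)
  moreover have "finite E"
    by (simp add: E_def finite_lists_length_eq)
  moreover have "multM S h = {e + u | e u. e \<in> E \<and> u \<in> submonoid_gen (set gs)}"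
    unfolding S E_def set_eq_iff multM_iff[OF A] by blast
  ultimately show "supported (multM S h) \<subseteq> ideal_pow ?R ?m h"
    using supported_subset_ideal[of "ideal_pow ?R ?m h" "set gs" E] ideal_ideal_pow[OF m(1)]
    by (auto simp flip: S)
qed

section \<open>From the Buchsbaum property of the ring to orders in the semigroup\<close>

lemma fps_X_power_mem_ideal_pow_iff:
  assumes "S = submonoid_gen (set gs)" "0 \<notin> set gs"
  shows "fps_X ^ n \<in> ideal_pow (semigroup_ring S :: 'k::field fps ring) (semigroup_ring_max S gs) h
    \<longleftrightarrow> n \<in> multM S h"
  by (simp add: ideal_pow_semigroup_ring_max[OF assms] fps_X_power_supported_iff)

text \<open>The order jump at \<open>w + c * m\<close> propagates to w + n for all n of large order
  and thus, looking at supports, to t^w f for all f in a high power of the maximal ideal. Hence the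
  initial form of t^w lies in H^0 and is killed by that of t^s.\<close>

lemma order_increases_if_buchsbaum:
  assumes S: "S = submonoid_gen (set gs)" and A: "0 \<notin> set gs"
    and B: "assoc_graded_buchsbaum (semigroup_ring S :: 'k::field fps ring) (semigroup_ring_max S gs)"
    and m: "m \<in> set gs" "\<And>g. g \<in> set gs \<Longrightarrow> m \<le> g"
    and w: "w \<in> multM S b" "w + c * m \<in> multM S (Suc (b + c))"
    and s: "s \<in> multM S e" "e \<noteq> 0"
  shows "s + w \<in> multM S (Suc (e + b))"
proof -
  let ?R = "semigroup_ring S :: 'k fps ring" and ?m = "semigroup_ring_max S gs :: 'k fps set"
  interpret cring ?R
    unfolding S by (rule cring_semigroup_ring)
  note mem = fps_X_power_mem_ideal_pow_iff[OF S A, where 'k = 'k]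
  \<comment> \<open>The \<open>Suc\<close> in the threshold supplies the strict inequality demanded
    by the pigeonhole argument.\<close>
  have "fps_X ^ w \<otimes>\<^bsub>?R\<^esub> f \<in> ideal_pow ?R ?m (Suc (b + j))"
    if "Suc (card (set gs) * (c * m)) \<le> j" "f \<in> ideal_pow ?R ?m j" for j f
  proof -
    have "w + n \<in> multM S (Suc (b + j))" if "n \<in> multM S j" for n
      using eventually_order_increases[OF A _ m] w(2) that \<open>_ \<le> j\<close> unfolding S by simp
    then have "fps_X ^ w * f \<in> supported (multM S (Suc (b + j)))"
      using that(2) unfolding ideal_pow_semigroup_ring_max[OF S A]
      by (auto simp: supported_def fps_X_power_nth elim!: fps_mult_nth_nonzero split: if_splits)
    then show ?thesis
      by (simp add: ideal_pow_semigroup_ring_max[OF S A]) (simp add: semigroup_ring_def)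
  qed
  from assoc_graded_buchsbaumD[OF ideal_semigroup_ring_max(1)[OF S] B _ this, where b = "fps_X ^ s" and e = e]
  have "fps_X ^ s \<otimes>\<^bsub>?R\<^esub> fps_X ^ w \<in> ideal_pow ?R ?m (Suc (e + b))"
    using w(1) s by (simp add: mem)
  then have "(fps_X ^ (s + w) :: 'k fps) \<in> ideal_pow ?R ?m (Suc (e + b))"
    by (simp add: semigroup_ring_def power_add)
  then show ?thesis
    by (simp only: mem)
qed

section \<open>Apery sets and the blowup\<close>

text \<open>If s in S is congruent to 1, then i s is an element of S in the class of i, so the
  minimum is attained. The lemma serves both S and its blowup.\<close>

lemma apery_elem_props:
  assumes S: "S = submonoid_gen A" and "finite A" "Gcd A = 1" "m \<noteq> 0"
  shows "apery_elem S m i \<in> S" "apery_elem S m i mod m = i mod m"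
proof -
  obtain s where "s \<in> S" "s mod m = 1 mod m"
    using submonoid_gen_Gcd_cong[OF assms(2,4)] assms(1,3) by auto
  then have "i * s \<in> S \<and> (i * s) mod m = i mod m"
    unfolding S by (metis submonoid_gen_mult mod_mult_right_eq mult.right_neutral)
  then have "apery_elem S m i \<in> S \<and> apery_elem S m i mod m = i mod m"
    unfolding apery_elem_def by (rule LeastI)
  then show "apery_elem S m i \<in> S" "apery_elem S m i mod m = i mod m" by auto
qed

text \<open>Congruent numbers differ by a multiple of g_1, and g_1 \<noteq> 0 makes the factor
  unique, so the \<open>THE\<close> in \<open>apery_a\<close> denotes it.\<close>

lemma apery_a_eq:
  assumes "hd gs \<noteq> 0"
    and "apery_elem (blowup_semigroup gs) (hd gs) i mod hd gs = apery_elem S (hd gs) i mod hd gs"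
  shows "int (apery_elem (blowup_semigroup gs) (hd gs) i) + apery_a S gs i * int (hd gs)
    = int (apery_elem S (hd gs) i)"
proof -
  let ?u = "int (apery_elem (blowup_semigroup gs) (hd gs) i)" and ?v = "int (apery_elem S (hd gs) i)"
  have "?u mod int (hd gs) = ?v mod int (hd gs)"
    using assms(2) by (simp flip: of_nat_mod)
  then obtain a where "?v - ?u = int (hd gs) * a"
    by (metis mod_eq_dvd_iff dvdE)
  then have a: "?u + a * int (hd gs) = ?v" by (simp add: algebra_simps)
  have "\<exists>!a. ?u + a * int (hd gs) = ?v"
  proof (rule ex1I)
    show "?u + a * int (hd gs) = ?v" by (rule a)
  next
    fix a' assume "?u + a' * int (hd gs) = ?v"
    with a have "a' * int (hd gs) = a * int (hd gs)" by linarith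
    then show "a' = a" using assms(1) by simp
  qed
  then show ?thesis
    unfolding apery_a_def by (rule theI')
qed

text \<open>Adding g_1 turns a generator g - g_1 of the blowup into the generator g of S, so N
  copies of g_1 make up for N such generators. Every further copy of g_1 raises the guaranteed order
  by one.\<close>

lemma blowup_order:
  assumes A: "0 \<notin> set gs" "gs \<noteq> []" "\<And>g. g \<in> set gs \<Longrightarrow> hd gs \<le> g"
    and u: "u \<in> blowup_semigroup gs"
  shows "\<exists>N. \<forall>n\<ge>N. u + n * hd gs \<in> multM (submonoid_gen (set gs)) n"
proof -
  let ?S = "submonoid_gen (set gs)" and ?m = "hd gs"
  have m: "?m \<in> set gs" using A(2) by simp
  have "\<exists>N. u + N * ?m \<in> multM ?S N"
    using u unfolding blowup_semigroup_def
  proof induction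
    case zero
    then show ?case using multM_mult[OF A(1) m, of 0] by (intro exI[of _ 0]) simp
  next
    case (add a s)
    then obtain N where N: "s + N * ?m \<in> multM ?S N" by blast
    show ?case
    proof (cases "a = ?m")
      case True
      \<comment> \<open>The generator g_1 of the blowup already lies in S = 0M, so N stays the
        same.\<close>
      have "?m \<in> multM ?S 0"
        using submonoid_gen_base[OF m] by (simp add: multM_def)
      from multM_add[OF A(1) this N] show ?thesis
        using True by (auto simp: add.assoc)
    next
      case False
      then obtain g where "g \<in> set gs" "a = g - ?m"
        using add.hyps(1) by (auto dest: list.set_sel(2)[OF A(2)])
      then have "a + s + Suc N * ?m = 1 * g + (s + N * ?m)"
        using A(3)[of g] by simp
      then show ?thesis
        using multM_add[OF A(1) multM_mult[OF A(1) \<open>g \<in> set gs\<close>] N] by (metis plus_1_eq_Suc)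
    qed
  qed
  then obtain N where N: "u + N * ?m \<in> multM ?S N" by blast
  have "u + n * ?m \<in> multM ?S n" if "N \<le> n" for n
  proof -
    from that obtain k where "n = N + k" using le_Suc_ex by blast
    then show ?thesis
      using multM_add[OF A(1) N multM_mult[OF A(1) m, of k]] by (simp add: algebra_simps)
  qed
  then show ?thesis by blast
qed

text \<open>The list is nonempty because the gcd of the empty set is 0; the generator 0 would
  violate minimality, being in every submonoid.\<close>

lemma numerical_semigroup_mingensD:
  assumes "numerical_semigroup_mingens S gs"
  shows "S = submonoid_gen (set gs)" "0 \<notin> set gs" "gs \<noteq> []" "Gcd (set gs) = 1"
    "g \<in> set gs \<Longrightarrow> hd gs \<le> g"
proof -
  show "S = submonoid_gen (set gs)" "gs \<noteq> []" "Gcd (set gs) = 1" "0 \<notin> set gs"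
    using assms submonoid_gen.zero unfolding numerical_semigroup_mingens_def by force+
  then show "g \<in> set gs \<Longrightarrow> hd gs \<le> g"
    using assms unfolding numerical_semigroup_mingens_def by (cases gs) auto
qed

section \<open>Maximality of the Apery elements with a_i > b_i\<close>

theorem proposition3p19:
  fixes S :: "nat set" and gs :: "nat list"
  assumes "infinite (UNIV :: ('k::field) set)"
    and "numerical_semigroup_mingens S gs"
    and "assoc_graded_buchsbaum (semigroup_ring S :: 'k fps ring) (semigroup_ring_max S gs)"
  shows "\<forall>i<hd gs. apery_a S gs i > int (apery_b S gs i) \<longrightarrow>
           apery_elem S (hd gs) i \<in> maxAp_M S (hd gs)"
proof (intro allI impI)
  fix i assume i: "i < hd gs" and ab: "apery_a S gs i > int (apery_b S gs i)"
  note S = numerical_semigroup_mingensD[OF assms(2)]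
  let ?m = "hd gs" and ?w = "apery_elem S (hd gs) i" and ?b = "apery_b S gs i"
  let ?w' = "apery_elem (blowup_semigroup gs) (hd gs) i"
  have m: "?m \<in> set gs" using S(3) by simp
  then have m0: "?m \<noteq> 0" using S(2) by metis
  have w: "?w \<in> S" "?w mod ?m = i mod ?m"
    using apery_elem_props[OF S(1) _ S(4) m0] by auto
  let ?B = "set (?m # map (\<lambda>g. g - ?m) (tl gs))"
  \<comment> \<open>The generators of the blowup again have gcd 1, as g = (g - g_1) + g_1; hence the
    blowup meets every residue class and its Apery elements exist.\<close>
  have "Gcd ?B dvd g" if "g \<in> set gs" for g
  proof (cases "g = ?m")
    case False
    then have "g - ?m \<in> ?B"
      using that by (cases gs) auto
    then have "Gcd ?B dvd (g - ?m) + ?m"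
      by (intro dvd_add Gcd_dvd) auto
    then show ?thesis using S(5)[OF that] by simp
  qed (simp add: Gcd_dvd)
  then have "Gcd ?B = 1"
    using S(4) Gcd_greatest[of "set gs" "Gcd ?B"] by (metis nat_dvd_1_iff_1)
  then have w': "?w' \<in> blowup_semigroup gs" "?w' mod ?m = i mod ?m"
    using apery_elem_props[OF blowup_semigroup_def _ _ m0] by auto
  \<comment> \<open>The integer a_i exceeds b_i \<ge> 0, so the conversion to a natural number loses
    nothing.\<close>
  define a where "a = nat (apery_a S gs i)"
  have "int ?w' + int a * int ?m = int ?w"
    using apery_a_eq[OF m0] w w' ab unfolding a_def by simp
  then have weq: "?w = ?w' + a * ?m"
    by (metis of_nat_add of_nat_eq_iff of_nat_mult)
  have "?b < a" using ab by (simp add: a_def)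
  have wb: "?w \<in> multM S ?b" "?w \<notin> multM S (Suc ?b)"
    using Max_multM[OF S(2)] w(1) unfolding apery_b_def S(1) by auto
  obtain N where N: "\<And>n. N \<le> n \<Longrightarrow> ?w' + n * ?m \<in> multM S n"
    using blowup_order[OF S(2,3,5) w'(1)] unfolding S(1) by blast
  \<comment> \<open>The order jump, with c = N: \<omega>_i + N g_1 equals \<omega>'_i + (a + N) g_1
    and so has order at least a + N \<ge> b + N + 1.\<close>
  have "?w + N * ?m \<in> multM S (Suc (?b + N))"
  proof -
    have "?w + N * ?m \<in> multM S (a + N)"
      using N[of "a + N"] weq by (simp add: algebra_simps)
    then show ?thesis
      using multM_antimono[OF S(2), of "Suc (?b + N)" "a + N"] \<open>?b < a\<close> unfolding S(1) by auto
  qed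
  note inc = order_increases_if_buchsbaum[OF S(1,2) assms(3) m S(5) wb(1) this]
  show "?w \<in> maxAp_M S ?m"
    unfolding maxAp_M_def
  proof (intro CollectI conjI ballI impI)
    show "?w \<in> apery_set S ?m"
      using i by (simp add: apery_set_def)
    fix v assume "le_M S ?w v"
    then obtain s where s: "s \<in> S" "?w + s = v" "ord_sg S ?w + ord_sg S s = ord_sg S v"
      by (auto simp: le_M_def)
    have ordw: "ord_sg S ?w = ?b"
      using ord_sg_eqI[OF S(2)] wb unfolding S(1) by blast
    note ords = ord_sg_mem[OF S(2), folded S(1), OF s(1)]
    show "v = ?w"
    proof (rule ccontr)
      assume "v \<noteq> ?w"
      then have "s \<noteq> 0" using s(2) by auto
      then have "s \<in> multM S 1"
        using s(1) by (auto simp: multM_def intro!: exI[of _ "[s]"])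
      then have "ord_sg S s \<noteq> 0" using ords(2) by (metis One_nat_def)
      \<comment> \<open>The Buchsbaum property forces the order of \<omega>_i + s above the sum of
        the two orders, whereas \<open>le_M\<close> makes it equal to that sum.\<close>
      from inc[OF _ ords(1) this] have "v \<in> multM S (Suc (ord_sg S v))"
        using s(2,3) ordw by (simp add: add.commute)
      moreover have "v \<in> S"
        using s(1,2) w(1) submonoid_gen_add unfolding S(1) by blast
      ultimately show False
        using ord_sg_mem(2)[OF S(2), folded S(1)] by blast
    qed
  qed
qed

end
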